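(* Let $\mathcal{T}_{\mathcal{I}}$ be a cluster tree and $\mathcal{T}_{\mathcal{I}\times\mathcal{I}}$ a block tree for it with admissible leaves $\mathcal{L}^+_{\mathcal{I}\times\mathcal{I}}$ and inadmissible leaves $\mathcal{L}^-_{\mathcal{I}\times\mathcal{I}}$. Assume: 1. for every $(t,s)\in\mathcal{L}^-_{\mathcal{I}\times\mathcal{I}}$ we have $t\in\mathcal{L}_{\mathcal{I}}$ or $s\in\mathcal{L}_{\mathcal{I}}$; 2. there is $m\in\mathbb{N}$ with $|\hat t|\le m$ for all leaves $t\in\mathcal{L}_{\mathcal{I}}$; 3. there is $p\in\mathbb{N}_0$ with $\operatorname{level}(t)\le p$ for all $t\in\mathcal{T}_{\mathcal{I}}$; 4. there is $C_{\text{sp}}\in\mathbb{N}$ with $|\{s\in\mathcal{T}_{\mathcal{I}}: (t,s)\in\mathcal{T}_{\mathcal{I}\times\mathcal{I}}\}|\le C_{\text{sp}}$ for all $t\in\mathcal{T}_{\mathcal{I}}$ and $|\{t\in\mathcal{T}_{\mathcal{I}}: (t,s)\in\mathcal{T}_{\mathcal{I}\times\mathcal{I}}\}|\le C_{\text{sp}}$ for all $s\in\mathcal{T}_{\mathcal{I}}$. Let $k\in\mathbb{N}$ be the local rank, let $W_{\text{mm}}$ be the bound for the operation count of the $\mathcal{H}$-matrix multiplication defined in the context (with the constants $C_{\text{ad}}$ and $C_{\text{mg}}$ appearing there), and let $\hat k:=\max\{k_{ts}:(t,s)\in\mathcal{L}_{\mathcal{I}\times\mathcal{I}}\}$. Then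 for every $(t,s,r)$ in the product tree $\mathcal{T}_{\mathcal{I}\times\mathcal{I}\times\mathcal{I}}$, $$W_{\text{mm}}(t,s,r)\le C_{\text{mm}}\,C_{\text{sp}}^2\,(p+1)^2\,\hat k^2\,(|\hat t|+|\hat s|+|\hat r|),$$ where $C_{\text{mm}}:=4+2C_{\text{up}}+C_{\text{mg}}$ and $C_{\text{up}}:=\max\{C_{\text{ad}},1\}$.
   Context: **Cluster tree.** Let $\mathcal{I}$ be a finite index set. A cluster tree $\mathcal{T}_{\mathcal{I}}$ is a rooted tree in which each node (cluster) $t$ is labeled with a subset $\hat t\subseteq\mathcal{I}$ such that the root is labeled with $\mathcal{I}$; if $t$ has sons, $\hat t=\bigcup_{t'\in\operatorname{sons}(t)}\hat t'$; and distinct sons of the same cluster have disjoint labels. $\mathcal{L}_{\mathcal{I}}$ is its set of leaves; $\operatorname{level}(t)$ is the distance of $t$ from the root (the root has level $0$). **Block tree.** A block tree $\mathcal{T}_{\mathcal{I}\times\mathcal{I}}$ for $\mathcal{T}_{\mathcal{I}}$ is a tree whose nodes (blocks) are pairs $(t,s)$ of clusters, whose root is $(r,r)$ with $r$ the root of $\mathcal{T}_{\mathcal{I}}$, and such that if a block $(t,s)$ has sons, its set of sons is $\operatorname{sons}(t)\times\operatorname{sons}(s)$. Its set of leaves $\mathcal{L}_{\mathcal{I}\times\mathcal{I}}$ is partitioned into a set $\mathcal{L}^+_{\mathcal{I}\times\mathcal{I}}$ of admissible leaves (on which $\mathcal{H}$-matrices of local rank $k$ have submatrices of rank at most $k$,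 stored in factorized form) and a set $\mathcal{L}^-_{\mathcal{I}\times\mathcal{I}}$ of inadmissible leaves (on which submatrices are stored as dense arrays). **Product tree.** The product tree $\mathcal{T}_{\mathcal{I}\times\mathcal{I}\times\mathcal{I}}$ is the minimal tree of triples of clusters whose root is $(q,q,q)$, with $q$ the root of $\mathcal{T}_{\mathcal{I}}$, and in which a node $(t,s,r)$ is a leaf if and only if $(t,s)\in\mathcal{L}_{\mathcal{I}\times\mathcal{I}}$ or $(s,r)\in\mathcal{L}_{\mathcal{I}\times\mathcal{I}}$, and otherwise has the set of sons $\operatorname{sons}(t)\times\operatorname{sons}(s)\times\operatorname{sons}(r)$. Then $(t,s,r)\in\mathcal{T}_{\mathcal{I}\times\mathcal{I}\times\mathcal{I}}$ implies $(t,s),(s,r)\in\mathcal{T}_{\mathcal{I}\times\mathcal{I}}$. **Local rank.** For $(t,s)\in\mathcal{L}_{\mathcal{I}\times\mathcal{I}}$ let $k_{ts}:=k$ if $(t,s)\in\mathcal{L}^+_{\mathcal{I}\times\mathcal{I}}$ and $k_{ts}:=\min\{|\hat t|,|\hat s|\}$ otherwise. **Constants.** $C_{\text{ad}}$ is a constant such that the truncated addition of a rank-$\ell$ matrix to a rank-$k$ block $(t,s)$ takes at most $C_{\text{ad}}(k+\ell)^2(|\hat t|+|\hat s|)$ operations; $C_{\text{mg}}$ is the constant in the bound for the work of merging low-rank submatrices into a larger low-rank matrix. Both enter only through the following definitions. **Operation counts.** For $(t,s)\in\mathcal{T}_{\mathcal{I}\times\mathcal{I}}$ (multiplication of an $\mathcal{H}$-matrix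 block with $\ell$ vectors): $$W_{\text{ev}}(t,s,\ell):=\begin{cases}2\ell k(|\hat t|+|\hat s|)&(t,s)\in\mathcal{L}^+_{\mathcal{I}\times\mathcal{I}},\\ \ell(2|\hat t||\hat s|+\min\{|\hat t|,|\hat s|\})&(t,s)\in\mathcal{L}^-_{\mathcal{I}\times\mathcal{I}},\\ \sum_{t'\in\operatorname{sons}(t),\,s'\in\operatorname{sons}(s)}W_{\text{ev}}(t',s',\ell)&\text{otherwise.}\end{cases}$$ For $t,s\in\mathcal{T}_{\mathcal{I}}$ (update by a matrix of rank $\ell$): $$W_{\text{up}}(t,s,\ell):=\begin{cases}\sum_{t'\in\operatorname{sons}(t),\,s'\in\operatorname{sons}(s)}W_{\text{up}}(t',s',\ell)&(t,s)\in\mathcal{T}_{\mathcal{I}\times\mathcal{I}}\setminus\mathcal{L}_{\mathcal{I}\times\mathcal{I}},\\ 2\ell|\hat t||\hat s|&(t,s)\in\mathcal{L}^-_{\mathcal{I}\times\mathcal{I}},\\ C_{\text{ad}}(k+\ell)^2(|\hat t|+|\hat s|)&\text{otherwise (i.e. } (t,s)\in\mathcal{L}^+_{\mathcal{I}\times\mathcal{I}}\text{ or }(t,s)\notin\mathcal{T}_{\mathcal{I}\times\mathcal{I}}).\end{cases}$$ For $(t,s),(s,r)\in\mathcal{T}_{\mathcal{I}\times\mathcal{I}}$ (matrix multiplication): $$W_{\text{mm}}(t,s,r):=\begin{cases}W_{\text{ev}}(s,r,k_{ts})+W_{\text{up}}(t,r,k_{ts})&(t,s)\in\mathcal{L}_{\mathcal{I}\times\mathcal{I}},\\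 W_{\text{ev}}(t,s,k_{sr})+W_{\text{up}}(t,r,k_{sr})&(t,s)\notin\mathcal{L}_{\mathcal{I}\times\mathcal{I}},\ (s,r)\in\mathcal{L}_{\mathcal{I}\times\mathcal{I}},\\ C_{\text{mg}}k^2(|\hat t|+|\hat r|)+\sum_{t'\in\operatorname{sons}(t),\,s'\in\operatorname{sons}(s),\,r'\in\operatorname{sons}(r)}W_{\text{mm}}(t',s',r')&\text{otherwise.}\end{cases}$$
   Formalization: Two conditions are added, as the claim fails without them: if there are no admissible leaves, k is at most k-hat; and if p = 0, C_sp = 1 and the root block is admissible, then 2 C_ad <= 8 + 3 C_mg. C_mg >= 0 is made explicit. *)

theory Defs
  imports Complex_Main
begin

section \<open>Rooted trees\<close>

text \<open>A tree is given by its nodes, its root and its map of sons; the values of the map outside the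
  nodes are irrelevant. Nodes are not identified with their labels: the label of a cluster is a
  separate function, since a cluster and its only son carry the same label.\<close>

record 'v rtree =
  verts :: "'v set"
  root :: 'v
  sons :: "'v \<Rightarrow> 'v set"

definition edges :: "'v rtree \<Rightarrow> ('v \<times> 'v) set" where
  "edges T = {(v, w). v \<in> verts T \<and> w \<in> sons T v}"

definition rooted_tree :: "'v rtree \<Rightarrow> bool" where
  "rooted_tree T \<longleftrightarrow>
     finite (verts T) \<and> root T \<in> verts T \<and>
     (\<forall>v\<in>verts T. sons T v \<subseteq> verts T) \<and>
     (\<forall>v\<in>verts T. root T \<notin> sons T v) \<and>
     (\<forall>v\<in>verts T. \<forall>w\<in>verts T. v \<noteq> w \<longrightarrow> sons T v \<inter> sons T w = {}) \<and>
     (\<forall>v\<in>verts T. (root T, v) \<in> (edges T)\<^sup>*)"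

definition leaves :: "'v rtree \<Rightarrow> 'v set" where
  "leaves T = {v \<in> verts T. sons T v = {}}"

definition level :: "'v rtree \<Rightarrow> 'v \<Rightarrow> nat" where
  "level T v = (LEAST n. (root T, v) \<in> edges T ^^ n)"

lemma rooted_tree_acyclic:
  assumes T: "rooted_tree T"
  shows "(v, v) \<notin> (edges T)\<^sup>+"
proof (cases "v \<in> verts T")
  case True
  then have "(root T, v) \<in> (edges T)\<^sup>*"
    using T by (auto simp: rooted_tree_def)
  then show ?thesis
  proof (induction rule: rtrancl_induct)
    case base
    show ?case
    proof
      assume "(root T, root T) \<in> (edges T)\<^sup>+"
      then obtain u where "(u, root T) \<in> edges T"
        by (meson tranclD2)
      then show False
        using T by (auto simp: rooted_tree_def edges_def)
    qed
  next
    case (step v w)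
    show ?case
    proof
      assume "(w, w) \<in> (edges T)\<^sup>+"
      then obtain u where u: "(w, u) \<in> (edges T)\<^sup>*" "(u, w) \<in> edges T"
        by (meson tranclD2)
      have "u = v"
        using T u(2) step.hyps(2) unfolding rooted_tree_def edges_def disjoint_iff by blast
      then have "(v, v) \<in> (edges T)\<^sup>+"
        using u(1) step.hyps(2) by (meson rtrancl_into_trancl2)
      then show False
        using step.IH by simp
    qed
  qed
next
  case False
  then show ?thesis
    by (auto simp: edges_def dest: tranclD)
qed

lemma card_descendants_less:
  assumes "rooted_tree T" "v \<in> verts T" "w \<in> sons T v"
  shows "card ((edges T)\<^sup>+ `` {w}) < card ((edges T)\<^sup>+ `` {v})"
proof (rule psubset_card_mono)
  have e: "(v, w) \<in> edges T"
    using assms by (simp add: edges_def)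
  have "(edges T)\<^sup>+ `` {v} \<subseteq> verts T"
    using assms(1) by (auto simp: edges_def rooted_tree_def dest!: tranclD2)
  then show "finite ((edges T)\<^sup>+ `` {v})"
    using assms(1) by (auto simp: rooted_tree_def intro: finite_subset)
  show "(edges T)\<^sup>+ `` {w} \<subset> (edges T)\<^sup>+ `` {v}"
    using e rooted_tree_acyclic[OF assms(1), of w] by (auto intro: trancl_into_trancl2)
qed


section \<open>Cluster tree, block tree, product tree\<close>

definition is_cluster_tree :: "'i set \<Rightarrow> 'c rtree \<Rightarrow> ('c \<Rightarrow> 'i set) \<Rightarrow> bool" where
  "is_cluster_tree I T lab \<longleftrightarrow>
     rooted_tree T \<and>
     (\<forall>t\<in>verts T. lab t \<subseteq> I) \<and>
     lab (root T) = I \<and>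
     (\<forall>t\<in>verts T. sons T t \<noteq> {} \<longrightarrow> lab t = (\<Union>t'\<in>sons T t. lab t')) \<and>
     (\<forall>t\<in>verts T. \<forall>t1\<in>sons T t. \<forall>t2\<in>sons T t. t1 \<noteq> t2 \<longrightarrow> lab t1 \<inter> lab t2 = {})"

definition is_block_tree :: "'c rtree \<Rightarrow> ('c \<times> 'c) rtree \<Rightarrow> bool" where
  "is_block_tree T B \<longleftrightarrow>
     rooted_tree B \<and>
     verts B \<subseteq> verts T \<times> verts T \<and>
     root B = (root T, root T) \<and>
     (\<forall>(t, s)\<in>verts B. sons B (t, s) \<noteq> {} \<longrightarrow> sons B (t, s) = sons T t \<times> sons T s)"

definition product_sons ::
    "'c rtree \<Rightarrow> ('c \<times> 'c) rtree \<Rightarrow> 'c \<times> 'c \<times> 'c \<Rightarrow> ('c \<times> 'c \<times> 'c) set" where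
  "product_sons T B = (\<lambda>(t, s, r).
     if (t, s) \<in> leaves B \<or> (s, r) \<in> leaves B then {} else sons T t \<times> sons T s \<times> sons T r)"

inductive_set product_verts :: "'c rtree \<Rightarrow> ('c \<times> 'c) rtree \<Rightarrow> ('c \<times> 'c \<times> 'c) set"
  for T :: "'c rtree" and B :: "('c \<times> 'c) rtree"
where
  root: "(root T, root T, root T) \<in> product_verts T B"
| sons: "v \<in> product_verts T B \<Longrightarrow> w \<in> product_sons T B v \<Longrightarrow> w \<in> product_verts T B"

definition product_tree :: "'c rtree \<Rightarrow> ('c \<times> 'c) rtree \<Rightarrow> ('c \<times> 'c \<times> 'c) rtree" where
  "product_tree T B =
     \<lparr>verts = product_verts T B, root = (root T, root T, root T), sons = product_sons T B\<rparr>"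

lemma product_tree_blocks:
  assumes B: "is_block_tree T B" and v: "(t, s, r) \<in> verts (product_tree T B)"
  shows "(t, s) \<in> verts B" "(s, r) \<in> verts B"
proof -
  have sons_B: "sons T t \<times> sons T s \<subseteq> verts B" if "(t, s) \<in> verts B" "(t, s) \<notin> leaves B" for t s
    using B that by (fastforce simp: is_block_tree_def rooted_tree_def leaves_def)
  have "(fst v, fst (snd v)) \<in> verts B \<and> snd v \<in> verts B" if "v \<in> product_verts T B" for v
    using that
  proof induction
    case root
    show ?case
      using B by (simp add: is_block_tree_def rooted_tree_def) metis
  next
    case (sons v w)
    obtain t s r where v: "v = (t, s, r)"
      by (cases v)
    have "(t, s) \<notin> leaves B" "(s, r) \<notin> leaves B" "w \<in> sons T t \<times> sons T s \<times> sons T r"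
      using sons.hyps(2) by (auto simp: v product_sons_def split: if_splits)
    then show ?case
      using sons.IH sons_B[of t s] sons_B[of s r] by (auto simp: v)
  qed
  from this[of "(t, s, r)"] v show "(t, s) \<in> verts B" "(s, r) \<in> verts B"
    by (auto simp: product_tree_def)
qed


section \<open>Operation counts\<close>

text \<open>Throughout, \<open>Lp\<close> and \<open>Lm\<close> are the sets of admissible and inadmissible leaves of the block
  tree \<open>B\<close>, and \<open>lab\<close> is the labelling of the cluster tree \<open>T\<close>. The guard
  \<^term>\<open>rooted_tree T \<and> t \<in> verts T\<close> in the recursive cases only serves to make the
  recursions terminate on arbitrary arguments; the equations without the guard follow below.\<close>

definition local_rank ::
    "('c \<Rightarrow> 'i set) \<Rightarrow> ('c \<times> 'c) set \<Rightarrow> nat \<Rightarrow> 'c \<Rightarrow> 'c \<Rightarrow> nat" where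
  "local_rank lab Lp k t s =
     (if (t, s) \<in> Lp then k else min (card (lab t)) (card (lab s)))"

definition max_local_rank ::
    "('c \<Rightarrow> 'i set) \<Rightarrow> ('c \<times> 'c) rtree \<Rightarrow> ('c \<times> 'c) set \<Rightarrow> nat \<Rightarrow> nat" where
  "max_local_rank lab B Lp k = Max {local_rank lab Lp k t s | t s. (t, s) \<in> leaves B}"

text \<open>If there are no admissible leaves, the parameter \<open>k\<close> does not enter this maximum, although
  it still enters \<open>W_up\<close> and \<open>W_mm\<close> below; otherwise the maximum is at least \<open>k\<close>.\<close>

function W_ev ::
    "'c rtree \<Rightarrow> ('c \<Rightarrow> 'i set) \<Rightarrow> ('c \<times> 'c) set \<Rightarrow> ('c \<times> 'c) set \<Rightarrow> nat \<Rightarrow>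
     'c \<Rightarrow> 'c \<Rightarrow> nat \<Rightarrow> real" where
  "W_ev T lab Lp Lm k t s l =
     (if (t, s) \<in> Lp then
        2 * real l * real k * (real (card (lab t)) + real (card (lab s)))
      else if (t, s) \<in> Lm then
        real l * (2 * real (card (lab t)) * real (card (lab s))
                  + min (real (card (lab t))) (real (card (lab s))))
      else if rooted_tree T \<and> t \<in> verts T then
        (\<Sum>t'\<in>sons T t. \<Sum>s'\<in>sons T s. W_ev T lab Lp Lm k t' s' l)
      else 0)"
  by pat_completeness auto
termination
  by (relation "measure (\<lambda>(T, lab, Lp, Lm, k, t, s, l). card ((edges T)\<^sup>+ `` {t}))")
     (auto intro: card_descendants_less)

function W_up ::
    "'c rtree \<Rightarrow> ('c \<Rightarrow> 'i set) \<Rightarrow> ('c \<times> 'c) rtree \<Rightarrow> ('c \<times> 'c) set \<Rightarrow> nat \<Rightarrow> real \<Rightarrow>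
     'c \<Rightarrow> 'c \<Rightarrow> nat \<Rightarrow> real" where
  "W_up T lab B Lm k Cad t s l =
     (if (t, s) \<in> verts B - leaves B then
        (if rooted_tree T \<and> t \<in> verts T then
           (\<Sum>t'\<in>sons T t. \<Sum>s'\<in>sons T s. W_up T lab B Lm k Cad t' s' l)
         else 0)
      else if (t, s) \<in> Lm then
        2 * real l * real (card (lab t)) * real (card (lab s))
      else
        Cad * (real k + real l)\<^sup>2 * (real (card (lab t)) + real (card (lab s))))"
  by pat_completeness auto
termination
  by (relation "measure (\<lambda>(T, lab, B, Lm, k, Cad, t, s, l). card ((edges T)\<^sup>+ `` {t}))")
     (auto intro: card_descendants_less)

function W_mm ::
    "'c rtree \<Rightarrow> ('c \<Rightarrow> 'i set) \<Rightarrow> ('c \<times> 'c) rtree \<Rightarrow> ('c \<times> 'c) set \<Rightarrow> ('c \<times> 'c) set \<Rightarrow>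
     nat \<Rightarrow> real \<Rightarrow> real \<Rightarrow> 'c \<Rightarrow> 'c \<Rightarrow> 'c \<Rightarrow> real" where
  "W_mm T lab B Lp Lm k Cad Cmg t s r =
     (if (t, s) \<in> leaves B then
        W_ev T lab Lp Lm k s r (local_rank lab Lp k t s)
        + W_up T lab B Lm k Cad t r (local_rank lab Lp k t s)
      else if (s, r) \<in> leaves B then
        W_ev T lab Lp Lm k t s (local_rank lab Lp k s r)
        + W_up T lab B Lm k Cad t r (local_rank lab Lp k s r)
      else if rooted_tree T \<and> t \<in> verts T then
        Cmg * (real k)\<^sup>2 * (real (card (lab t)) + real (card (lab r)))
        + (\<Sum>t'\<in>sons T t. \<Sum>s'\<in>sons T s. \<Sum>r'\<in>sons T r.
             W_mm T lab B Lp Lm k Cad Cmg t' s' r')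
      else 0)"
  by pat_completeness auto
termination
  by (relation "measure (\<lambda>(T, lab, B, Lp, Lm, k, Cad, Cmg, t, s, r).
        card ((edges T)\<^sup>+ `` {t}))")
     (auto intro: card_descendants_less)

declare W_ev.simps [simp del] W_up.simps [simp del] W_mm.simps [simp del]

lemma W_ev_rec:
  assumes "rooted_tree T" "t \<in> verts T" "(t, s) \<notin> Lp" "(t, s) \<notin> Lm"
  shows "W_ev T lab Lp Lm k t s l =
    (\<Sum>(t', s')\<in>sons T t \<times> sons T s. W_ev T lab Lp Lm k t' s' l)"
  using assms by (simp add: W_ev.simps[of T lab Lp Lm k t s l] sum.cartesian_product)

lemma W_up_rec:
  assumes "rooted_tree T" "t \<in> verts T" "(t, s) \<in> verts B - leaves B"
  shows "W_up T lab B Lm k Cad t s l =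
    (\<Sum>(t', s')\<in>sons T t \<times> sons T s. W_up T lab B Lm k Cad t' s' l)"
  using assms by (simp add: W_up.simps[of T lab B Lm k Cad t s l] sum.cartesian_product)

lemma W_mm_rec:
  assumes "rooted_tree T" "t \<in> verts T" "(t, s) \<notin> leaves B" "(s, r) \<notin> leaves B"
  shows "W_mm T lab B Lp Lm k Cad Cmg t s r =
    Cmg * (real k)\<^sup>2 * (real (card (lab t)) + real (card (lab r)))
    + (\<Sum>(t', s', r')\<in>sons T t \<times> sons T s \<times> sons T r. W_mm T lab B Lp Lm k Cad Cmg t' s' r')"
  using assms
  by (simp add: W_mm.simps[of T lab B Lp Lm k Cad Cmg t s r] sum.cartesian_product)

end

theory Submission
  imports Defs
begin

text \<open>Every block leaf costs at most \<open>2 * l * khat\<close> (evaluation) or \<open>4 * Cup * khat\<^sup>2\<close> (update) per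
  index of its two clusters, and the labels of the clusters of one level are disjoint. In the whole
  multiplication, a block \<open>d\<close> levels below the starting triple is charged by product leaves on its
  own level or above, on each level by at most \<open>Csp\<close> of them, and each cluster has at most \<open>Csp\<close>
  blocks. If the starting triple is not itself a product leaf, the product leaves lie on the levels
  \<open>1, \<dots>, p\<close>, so level \<open>d\<close> is charged \<open>d * Csp\<^sup>2\<close> times and the sum \<open>p * (p + 1) / 2\<close> halves the
  constant \<open>4 * Cup\<close> to the \<open>2 * Cup\<close> of the statement. Starting triples that are product leaves
  only pay one factor \<open>Csp * (p + 1)\<close>.\<close>


section \<open>Sums over fibres and sons\<close>

text \<open>Double counting: after grouping by the value of \<open>h\<close>, each
  \<open>g q\<close> occurs at most \<open>c\<close> times. It is applied with
  \<open>c = Csp\<close>, where sparsity limits how many blocks or triples project to one cluster or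
  block.\<close>

lemma sum_fibre_bound:
  fixes g :: "'b \<Rightarrow> real"
  assumes "finite P" "finite Q" "h ` P \<subseteq> Q"
    and nonneg: "\<And>q. q \<in> Q \<Longrightarrow> 0 \<le> g q"
    and fibre: "\<And>q. q \<in> Q \<Longrightarrow> card {v \<in> P. h v = q} \<le> c"
  shows "(\<Sum>v\<in>P. g (h v)) \<le> real c * (\<Sum>q\<in>Q. g q)"
proof -
  have "(\<Sum>v\<in>P. g (h v)) = (\<Sum>q\<in>Q. \<Sum>v\<in>{v \<in> P. h v = q}. g (h v))"
    using sum.group[OF assms(1-3), of "\<lambda>v. g (h v)"] by simp
  also have "\<dots> = (\<Sum>q\<in>Q. real (card {v \<in> P. h v = q}) * g q)"
    by (intro sum.cong refl) simp
  also have "\<dots> \<le> (\<Sum>q\<in>Q. real c * g q)"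
    using nonneg fibre by (intro sum_mono mult_right_mono) auto
  finally show ?thesis
    by (simp add: sum_distrib_left)
qed

text \<open>One step of a recursive estimate, summed over a layer: the families of sons are
  disjoint, so the inner sums merge into a single sum over the next layer.\<close>

lemma sum_sons_bound:
  fixes f g :: "'v \<Rightarrow> real"
  assumes "finite P" "\<And>v. v \<in> P \<Longrightarrow> finite (S v)"
    and disjoint: "\<And>v w. v \<in> P \<Longrightarrow> w \<in> P \<Longrightarrow> v \<noteq> w \<Longrightarrow> S v \<inter> S w = {}"
    and step: "\<And>v. v \<in> P \<Longrightarrow> f v \<le> g v + (\<Sum>w\<in>S v. f w)"
  shows "(\<Sum>v\<in>P. f v) \<le> (\<Sum>v\<in>P. g v) + (\<Sum>w\<in>(\<Union>v\<in>P. S v). f w)"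
proof -
  have "(\<Sum>w\<in>(\<Union>v\<in>P. S v). f w) = (\<Sum>v\<in>P. \<Sum>w\<in>S v. f w)"
    using assms by (intro sum.UNION_disjoint) auto
  then show ?thesis
    using sum_mono[of P f "\<lambda>v. g v + (\<Sum>w\<in>S v. f w)"] step by (simp add: sum.distrib)
qed


section \<open>Paths in rooted trees\<close>

text \<open>The root has no parent and every node has at most one, so two paths from the root to
  \<open>v\<close> agree when followed backwards and reach the root simultaneously.\<close>

lemma rooted_tree_path_length_unique:
  assumes T: "rooted_tree T"
  shows "(root T, v) \<in> edges T ^^ a \<Longrightarrow> (root T, v) \<in> edges T ^^ b \<Longrightarrow> a = b"
proof (induction a arbitrary: v b)
  case 0
  then show ?case
    using T by (cases b) (auto simp: edges_def rooted_tree_def)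
next
  case (Suc a)
  then obtain u where u: "(root T, u) \<in> edges T ^^ a" "(u, v) \<in> edges T"
    by auto
  show ?case
  proof (cases b)
    case 0
    then show ?thesis
      using T u(2) Suc.prems(2) by (auto simp: edges_def rooted_tree_def)
  next
    case (Suc b')
    then obtain u' where u': "(root T, u') \<in> edges T ^^ b'" "(u', v) \<in> edges T"
      using Suc.prems(2) by auto
    have "u' = u"
      using T u(2) u'(2) unfolding rooted_tree_def edges_def disjoint_iff by blast
    then show ?thesis
      using Suc.IH u(1) u'(1) Suc by blast
  qed
qed

lemma level_eq:
  assumes "rooted_tree T" "(root T, v) \<in> edges T ^^ n"
  shows "level T v = n"
  unfolding level_def
  using assms(2) rooted_tree_path_length_unique[OF assms(1)] by (intro Least_equality) auto

text \<open>A longer path below \<open>v\<close> would extend a path from the root to a node of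
  level above \<open>p\<close>. This turns the bound on levels into a number of remaining layers, on
  which the later inductions run.\<close>

lemma no_descendants_beyond_depth:
  assumes T: "rooted_tree T" and v: "v \<in> verts T"
    and depth: "\<And>t. t \<in> verts T \<Longrightarrow> level T t \<le> p"
  shows "(edges T ^^ Suc p) `` {v} = {}"
proof -
  have False if u: "(v, u) \<in> edges T ^^ Suc p" for u
  proof -
    obtain a where "(root T, v) \<in> edges T ^^ a"
      using T v by (auto simp: rooted_tree_def rtrancl_is_UN_relpow)
    then have "(root T, u) \<in> edges T ^^ (a + Suc p)"
      using u relpow_add[of a "Suc p" "edges T"] by (auto simp del: relpow.simps)
    then have "level T u = a + Suc p"
      by (rule level_eq[OF T])
    moreover have "u \<in> verts T"
      using u T by (auto simp: edges_def rooted_tree_def)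
    ultimately show False
      using depth[of u] by simp
  qed
  then show ?thesis
    by auto
qed

lemma depth_zero_root:
  assumes T: "rooted_tree T" and v: "v \<in> verts T" and "level T v = 0"
  shows "v = root T"
proof -
  obtain a where a: "(root T, v) \<in> edges T ^^ a"
    using T v by (auto simp: rooted_tree_def rtrancl_is_UN_relpow)
  then show ?thesis
    using level_eq[OF T a] assms(3) by simp
qed

text \<open>Peels off the first step of a path, not the last as the recursion of \<open>^^\<close>
  does: replacing \<open>X\<close> by its next layer lowers the exponent by one.\<close>

lemma relpow_Image_Suc: "(R ^^ Suc n) `` X = (R ^^ n) `` (R `` X)"
  by (simp add: relcomp_Image flip: relpow_commute)


section \<open>The weight of a block subtree\<close>

text \<open>All counts are bounded by the sum of \<open>card (lab t') + card (lab s')\<close> over all blocks below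
  \<open>(t, s)\<close>; a pair that is not a block counts as a leaf, as in \<open>W_up\<close>.\<close>

function subtree_weight ::
    "'c rtree \<Rightarrow> ('c \<Rightarrow> 'i set) \<Rightarrow> ('c \<times> 'c) rtree \<Rightarrow> 'c \<Rightarrow> 'c \<Rightarrow> real" where
  "subtree_weight T lab B t s =
     real (card (lab t)) + real (card (lab s)) +
     (if (t, s) \<in> verts B - leaves B \<and> rooted_tree T \<and> t \<in> verts T then
        (\<Sum>t'\<in>sons T t. \<Sum>s'\<in>sons T s. subtree_weight T lab B t' s')
      else 0)"
  by pat_completeness auto
termination
  by (relation "measure (\<lambda>(T, lab, B, t, s). card ((edges T)\<^sup>+ `` {t}))")
     (auto intro: card_descendants_less)

declare subtree_weight.simps [simp del]

locale sparse_block_tree =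
  fixes I :: "'i set" and T :: "'c rtree" and lab :: "'c \<Rightarrow> 'i set"
    and B :: "('c \<times> 'c) rtree" and Csp :: nat
  assumes finite_index: "finite I"
    and cluster_tree: "is_cluster_tree I T lab"
    and block_tree: "is_block_tree T B"
    and sparse_row: "\<And>t. t \<in> verts T \<Longrightarrow> card {s \<in> verts T. (t, s) \<in> verts B} \<le> Csp"
    and sparse_col: "\<And>s. s \<in> verts T \<Longrightarrow> card {t \<in> verts T. (t, s) \<in> verts B} \<le> Csp"
begin

abbreviation csize :: "'c \<Rightarrow> real" where
  "csize t \<equiv> real (card (lab t))"

abbreviation weight :: "'c set \<Rightarrow> real" where
  "weight X \<equiv> \<Sum>t\<in>X. csize t"

abbreviation F :: "'c \<Rightarrow> 'c \<Rightarrow> real" where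
  "F \<equiv> subtree_weight T lab B"

section \<open>Structure of clusters, blocks and their sons\<close>

lemma trees: "rooted_tree T" "rooted_tree B"
  using cluster_tree block_tree by (auto simp: is_cluster_tree_def is_block_tree_def)

lemma finite_verts: "finite (verts T)" "finite (verts B)"
  using trees by (auto simp: rooted_tree_def)

lemma block_clusters: "(t, s) \<in> verts B \<Longrightarrow> t \<in> verts T \<and> s \<in> verts T"
  using block_tree by (auto simp: is_block_tree_def)

lemma sons_verts: "t \<in> verts T \<Longrightarrow> sons T t \<subseteq> verts T"
  using trees by (auto simp: rooted_tree_def)

lemma finite_sons: "t \<in> verts T \<Longrightarrow> finite (sons T t)"
  using sons_verts finite_verts finite_subset by blast

lemma sons_disjoint:
  "t \<in> verts T \<Longrightarrow> s \<in> verts T \<Longrightarrow> t \<noteq> s \<Longrightarrow> sons T t \<inter> sons T s = {}"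
  using trees by (auto simp: rooted_tree_def)

lemma sons_block:
  assumes "(t, s) \<in> verts B - leaves B"
  shows "sons T t \<times> sons T s \<subseteq> verts B"
proof -
  have "sons B (t, s) \<noteq> {}" "sons B (t, s) \<subseteq> verts B"
    using assms trees by (auto simp: rooted_tree_def leaves_def)
  then show ?thesis
    using assms block_tree by (fastforce simp: is_block_tree_def)
qed

lemma edges_Image: "X \<subseteq> verts T \<Longrightarrow> edges T `` X = (\<Union>t\<in>X. sons T t)"
  by (auto simp: edges_def)

lemma edges_Image_verts: "X \<subseteq> verts T \<Longrightarrow> edges T `` X \<subseteq> verts T"
  using sons_verts by (auto simp: edges_def)

lemma cluster_induct [consumes 1, case_names cluster]:
  assumes "t \<in> verts T"
    and step: "\<And>t. t \<in> verts T \<Longrightarrow> (\<And>t'. t' \<in> sons T t \<Longrightarrow> Q t') \<Longrightarrow> Q t"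
  shows "Q t"
  using assms(1)
proof (induction "card ((edges T)\<^sup>+ `` {t})" arbitrary: t rule: less_induct)
  case less
  show ?case
  proof (rule step)
    fix t' assume "t' \<in> sons T t"
    then show "Q t'"
      using less.hyps[of t'] card_descendants_less[OF trees(1) less.prems] sons_verts[OF less.prems]
      by blast
  qed (fact less.prems)
qed

text \<open>The labels of the sons partition the label of \<open>t\<close>, so equality holds unless
  \<open>t\<close> is a leaf, where the left-hand side is 0.\<close>

lemma weight_sons_le:
  assumes t: "t \<in> verts T"
  shows "weight (sons T t) \<le> csize t"
proof (cases "sons T t = {}")
  case False
  have fin: "finite (lab s)" if "s \<in> verts T" for s
    using that finite_index cluster_tree by (auto simp: is_cluster_tree_def intro: finite_subset)
  have "card (\<Union>s\<in>sons T t. lab s) = (\<Sum>s\<in>sons T t. card (lab s))"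
    using t fin sons_verts finite_sons cluster_tree
    by (intro card_UN_disjoint) (auto simp: is_cluster_tree_def)
  moreover have "lab t = (\<Union>s\<in>sons T t. lab s)"
    using t False cluster_tree by (auto simp: is_cluster_tree_def)
  ultimately show ?thesis
    by simp
qed simp

text \<open>No two clusters share a son, so nothing is counted twice and the total weight does not
  grow from one layer to the next.\<close>

lemma weight_edges_le:
  assumes X: "X \<subseteq> verts T"
  shows "weight (edges T `` X) \<le> weight X"
proof -
  have "weight (edges T `` X) = (\<Sum>t\<in>X. weight (sons T t))"
    unfolding edges_Image[OF X]
  proof (rule sum.UNION_disjoint)
    show "finite X"
      using X finite_verts finite_subset by blast
    show "\<forall>t\<in>X. finite (sons T t)"
      using X finite_sons by blast
    show "\<forall>t\<in>X. \<forall>s\<in>X. t \<noteq> s \<longrightarrow> sons T t \<inter> sons T s = {}"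
      using X sons_disjoint by blast
  qed
  also have "\<dots> \<le> weight X"
    using X weight_sons_le by (intro sum_mono) auto
  finally show ?thesis .
qed

section \<open>The subtree weight and its sums over layers\<close>

lemma subtree_weight_nonneg: "0 \<le> F t s"
proof -
  have "0 \<le> subtree_weight T' lab' B' t s"
    for T' :: "'c rtree" and lab' :: "'c \<Rightarrow> 'i set" and B' :: "('c \<times> 'c) rtree"
    by (induction T' lab' B' t s rule: subtree_weight.induct)
       (subst subtree_weight.simps, auto intro!: add_nonneg_nonneg sum_nonneg)
  then show ?thesis .
qed

lemma subtree_weight_inner:
  assumes "(t, s) \<in> verts B - leaves B"
  shows "F t s = csize t + csize s + (\<Sum>(t', s')\<in>sons T t \<times> sons T s. F t' s')"
proof -
  have "t \<in> verts T"
    using assms block_clusters by blast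
  then have "F t s = csize t + csize s + (\<Sum>t'\<in>sons T t. \<Sum>s'\<in>sons T s. F t' s')"
    using assms trees(1) subtree_weight.simps[of T lab B t s] by simp
  then show ?thesis
    by (simp only: sum.cartesian_product)
qed

lemma subtree_weight_outer:
  assumes "(t, s) \<notin> verts B - leaves B"
  shows "F t s = csize t + csize s"
  using assms subtree_weight.simps[of T lab B t s] by auto

lemma size_le_subtree_weight: "csize t + csize s \<le> F t s"
  using subtree_weight.simps[of T lab B t s] by (simp add: sum_nonneg subtree_weight_nonneg)

text \<open>A layer is a set \<open>X \<subseteq> verts T\<close>; the next layer is \<open>edges T `` X\<close>, and \<open>edges T ^^ n `` X = {}\<close>
  says that at most \<open>n\<close> layers are left.\<close>

lemma layer_card_bound:
  assumes X: "X \<subseteq> verts T" and Y: "Y \<subseteq> verts T" and Q: "Q \<subseteq> (X \<times> Y) \<inter> verts B"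
  shows "(\<Sum>(t, s)\<in>Q. csize t) \<le> real Csp * weight X"
    and "(\<Sum>(t, s)\<in>Q. csize s) \<le> real Csp * weight Y"
proof -
  have fin: "finite X" "finite Y" "finite Q"
    using X Y Q finite_verts by (auto intro: finite_subset)
  \<comment> \<open>A fibre of the first projection embeds into a block row, a fibre of the second
    into a block column.\<close>
  have row: "card {v \<in> Q. fst v = t} \<le> Csp" if "t \<in> X" for t
  proof -
    have "card {v \<in> Q. fst v = t} \<le> card {s \<in> verts T. (t, s) \<in> verts B}"
      using Q Y finite_verts by (intro card_inj_on_le[of snd]) (auto simp: inj_on_def)
    then show ?thesis
      using sparse_row[of t] that X by auto
  qed
  have col: "card {v \<in> Q. snd v = s} \<le> Csp" if "s \<in> Y" for s
  proof -
    have "card {v \<in> Q. snd v = s} \<le> card {t \<in> verts T. (t, s) \<in> verts B}"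
      using Q X finite_verts by (intro card_inj_on_le[of fst]) (auto simp: inj_on_def)
    then show ?thesis
      using sparse_col[of s] that Y by auto
  qed
  have "(\<Sum>v\<in>Q. csize (fst v)) \<le> real Csp * weight X"
    using Q row by (intro sum_fibre_bound fin) auto
  then show "(\<Sum>(t, s)\<in>Q. csize t) \<le> real Csp * weight X"
    by (simp add: case_prod_beta)
  have "(\<Sum>v\<in>Q. csize (snd v)) \<le> real Csp * weight Y"
    using Q col by (intro sum_fibre_bound fin) auto
  then show "(\<Sum>(t, s)\<in>Q. csize s) \<le> real Csp * weight Y"
    by (simp add: case_prod_beta)
qed

text \<open>Subtracting the own sizes leaves the subtree weights of the sons of the non-leaf blocks
  of \<open>Q\<close>. These sons are blocks of the next layer, to which the assumed bound with
  \<open>C\<close> applies.\<close>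

lemma layer_step_bound:
  assumes X: "X \<subseteq> verts T" and Y: "Y \<subseteq> verts T"
    and sons_bound: "\<And>Q. Q \<subseteq> ((edges T `` X) \<times> (edges T `` Y)) \<inter> verts B \<Longrightarrow>
      (\<Sum>(t, s)\<in>Q. F t s) \<le> C * (weight (edges T `` X) + weight (edges T `` Y))"
    and C: "0 \<le> C" and Q: "Q \<subseteq> (X \<times> Y) \<inter> verts B"
  shows "(\<Sum>(t, s)\<in>Q. F t s - (csize t + csize s)) \<le> C * (weight X + weight Y)"
proof -
  define N where "N = Q - leaves B"
  define S where "S = (\<lambda>(t, s). sons T t \<times> sons T s)"
  have fin: "finite Q" "finite N"
    using Q finite_verts by (auto simp: N_def intro: finite_subset)
  have N: "t \<in> X" "s \<in> Y" "t \<in> verts T" "s \<in> verts T" "(t, s) \<in> verts B - leaves B"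
    if "(t, s) \<in> N" for t s
    using that Q X Y by (auto simp: N_def)
  have "(\<Sum>(t, s)\<in>Q. F t s - (csize t + csize s)) = (\<Sum>(t, s)\<in>N. F t s - (csize t + csize s))"
    using fin subtree_weight_outer by (intro sum.mono_neutral_right) (auto simp: N_def)
  also have "\<dots> = (\<Sum>v\<in>N. \<Sum>(t, s)\<in>S v. F t s)"
    using N(5) subtree_weight_inner by (intro sum.cong) (auto simp: S_def)
  also have "\<dots> = (\<Sum>(t, s)\<in>(\<Union>v\<in>N. S v). F t s)"
  proof (rule sum.UNION_disjoint[symmetric])
    show "\<forall>v\<in>N. finite (S v)"
      using N finite_sons by (auto simp: S_def)
    show "\<forall>v\<in>N. \<forall>w\<in>N. v \<noteq> w \<longrightarrow> S v \<inter> S w = {}"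
    proof (intro ballI impI)
      fix v w
      assume *: "v \<in> N" "w \<in> N" "v \<noteq> w"
      obtain t s t' s' where vw: "v = (t, s)" "w = (t', s')"
        by (cases v, cases w)
      \<comment> \<open>Distinct blocks differ in a coordinate; the sons in that coordinate are
        disjoint, hence so are the products.\<close>
      then have "sons T t \<inter> sons T t' = {} \<or> sons T s \<inter> sons T s' = {}"
        using * N(3,4) sons_disjoint by blast
      then show "S v \<inter> S w = {}"
        by (auto simp: S_def vw)
    qed
  qed (fact fin)
  also have "\<dots> \<le> C * (weight (edges T `` X) + weight (edges T `` Y))"
  proof (rule sons_bound)
    have "S (t, s) \<subseteq> ((edges T `` X) \<times> (edges T `` Y)) \<inter> verts B" if "(t, s) \<in> N" for t s
      using N[OF that] sons_block[of t s] by (auto simp: S_def edges_def)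
    then show "(\<Union>v\<in>N. S v) \<subseteq> ((edges T `` X) \<times> (edges T `` Y)) \<inter> verts B"
      by auto
  qed
  also have "\<dots> \<le> C * (weight X + weight Y)"
    using C weight_edges_le[OF X] weight_edges_le[OF Y] by (intro mult_left_mono) auto
  finally show ?thesis .
qed

text \<open>By sparsity, each of the at most \<open>n\<close> remaining layers contributes at most
  \<open>Csp * (weight X + weight Y)\<close>. It suffices that \<open>X\<close> runs out of layers,
  because a block needs a cluster in both coordinates.\<close>

lemma layer_weight_bound:
  assumes "X \<subseteq> verts T" "Y \<subseteq> verts T" "(edges T ^^ n) `` X = {}" "Q \<subseteq> (X \<times> Y) \<inter> verts B"
  shows "(\<Sum>(t, s)\<in>Q. F t s) \<le> real Csp * real n * (weight X + weight Y)"
  using assms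
proof (induction n arbitrary: X Y Q)
  case 0
  then have "Q = {}"
    by auto
  then show ?case
    by simp
next
  case (Suc n)
  have "(\<Sum>(t, s)\<in>Q. F t s - (csize t + csize s)) \<le> real Csp * real n * (weight X + weight Y)"
  proof (rule layer_step_bound[OF Suc.prems(1,2) _ _ Suc.prems(4)])
    fix R
    assume "R \<subseteq> ((edges T `` X) \<times> (edges T `` Y)) \<inter> verts B"
    then show "(\<Sum>(t, s)\<in>R. F t s)
        \<le> real Csp * real n * (weight (edges T `` X) + weight (edges T `` Y))"
      using Suc.prems(3) edges_Image_verts[OF Suc.prems(1)] edges_Image_verts[OF Suc.prems(2)]
      unfolding relpow_Image_Suc by (intro Suc.IH)
  qed simp
  moreover have "(\<Sum>(t, s)\<in>Q. F t s) =
      (\<Sum>(t, s)\<in>Q. F t s - (csize t + csize s)) + (\<Sum>(t, s)\<in>Q. csize t) + (\<Sum>(t, s)\<in>Q. csize s)"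
    by (simp add: sum.distrib[symmetric] case_prod_beta)
  ultimately show ?case
    using layer_card_bound[OF Suc.prems(1,2,4)] by (simp add: algebra_simps)
qed

text \<open>Without the sizes of the starting layer, one of the \<open>Suc n\<close> layers drops
  out.\<close>

lemma layer_proper_weight_bound:
  assumes "X \<subseteq> verts T" "Y \<subseteq> verts T" "(edges T ^^ Suc n) `` X = {}" "Q \<subseteq> (X \<times> Y) \<inter> verts B"
  shows "(\<Sum>(t, s)\<in>Q. F t s - (csize t + csize s)) \<le> real Csp * real n * (weight X + weight Y)"
proof (rule layer_step_bound[OF assms(1,2) _ _ assms(4)])
  fix R
  assume "R \<subseteq> ((edges T `` X) \<times> (edges T `` Y)) \<inter> verts B"
  then show "(\<Sum>(t, s)\<in>R. F t s)
      \<le> real Csp * real n * (weight (edges T `` X) + weight (edges T `` Y))"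
    using assms(3) edges_Image_verts[OF assms(1)] edges_Image_verts[OF assms(2)]
    unfolding relpow_Image_Suc by (intro layer_weight_bound)
qed simp

text \<open>One factor \<open>Csp\<close> counts the triples over a given block, the other the
  blocks at a given cluster. The pair \<open>(t, r)\<close> need not be a block, so its sizes are
  charged to \<open>(t, s)\<close> and \<open>(s, r)\<close>; only the proper part of
  \<open>F t r\<close>, which vanishes outside \<open>B\<close>, is charged to
  \<open>(t, r)\<close>.\<close>

lemma triple_layer_bounds:
  assumes X: "X \<subseteq> verts T" and Y: "Y \<subseteq> verts T" and Z: "Z \<subseteq> verts T"
    and P: "P \<subseteq> {(t, s, r). t \<in> X \<and> s \<in> Y \<and> r \<in> Z \<and> (t, s) \<in> verts B \<and> (s, r) \<in> verts B}"
    and n: "(edges T ^^ Suc n) `` X = {}" "(edges T ^^ Suc n) `` Y = {}"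
  shows "(\<Sum>(t, s, r)\<in>P. csize t + csize r) \<le> (real Csp)\<^sup>2 * (weight X + weight Z)"
    and "(\<Sum>(t, s, r)\<in>P. F t s) \<le> (real Csp)\<^sup>2 * real (Suc n) * (weight X + weight Y)"
    and "(\<Sum>(t, s, r)\<in>P. F s r) \<le> (real Csp)\<^sup>2 * real (Suc n) * (weight Y + weight Z)"
    and "(\<Sum>(t, s, r)\<in>P. F t r) \<le> (real Csp)\<^sup>2 * real (Suc n) * (weight X + weight Z)"
proof -
  have fin: "finite P"
    using P X Y Z finite_verts
    by (intro finite_subset[of P "verts T \<times> verts T \<times> verts T"]) auto
  have ts: "(\<Sum>(t, s, r)\<in>P. g t s) \<le> real Csp * (\<Sum>(t, s)\<in>(X \<times> Y) \<inter> verts B. g t s)"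
    if g: "\<And>t s. 0 \<le> g t s" for g :: "'c \<Rightarrow> 'c \<Rightarrow> real"
  proof -
    have "card {v \<in> P. (fst v, fst (snd v)) = q} \<le> Csp" if "q \<in> (X \<times> Y) \<inter> verts B" for q
    proof -
      have "card {v \<in> P. (fst v, fst (snd v)) = q} \<le> card {r \<in> verts T. (snd q, r) \<in> verts B}"
        using P Z finite_verts
        by (intro card_inj_on_le[of "\<lambda>v. snd (snd v)"]) (auto simp: inj_on_def)
      then show ?thesis
        using sparse_row[of "snd q"] that Y by auto
    qed
    then have "(\<Sum>v\<in>P. (\<lambda>(t, s). g t s) (fst v, fst (snd v)))
        \<le> real Csp * (\<Sum>q\<in>(X \<times> Y) \<inter> verts B. (\<lambda>(t, s). g t s) q)"
      using P g finite_verts fin by (intro sum_fibre_bound) auto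
    then show ?thesis
      by (simp add: case_prod_beta)
  qed
  have sr: "(\<Sum>(t, s, r)\<in>P. g s r) \<le> real Csp * (\<Sum>(s, r)\<in>(Y \<times> Z) \<inter> verts B. g s r)"
    if g: "\<And>t s. 0 \<le> g t s" for g :: "'c \<Rightarrow> 'c \<Rightarrow> real"
  proof -
    have "card {v \<in> P. snd v = q} \<le> Csp" if "q \<in> (Y \<times> Z) \<inter> verts B" for q
    proof -
      have "card {v \<in> P. snd v = q} \<le> card {t \<in> verts T. (t, fst q) \<in> verts B}"
        using P X finite_verts by (intro card_inj_on_le[of fst]) (auto simp: inj_on_def)
      then show ?thesis
        using sparse_col[of "fst q"] that Y by auto
    qed
    then have "(\<Sum>v\<in>P. (\<lambda>(s, r). g s r) (snd v))
        \<le> real Csp * (\<Sum>q\<in>(Y \<times> Z) \<inter> verts B. (\<lambda>(s, r). g s r) q)"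
      using P g finite_verts fin by (intro sum_fibre_bound) auto
    then show ?thesis
      by (simp add: case_prod_beta)
  qed
  \<comment> \<open>The free coordinate is the middle cluster \<open>s\<close>; there are at most
    \<open>Csp\<close> choices because \<open>(t, s)\<close> is a block.\<close>
  have tr: "(\<Sum>(t, s, r)\<in>{(t, s, r) \<in> P. (t, r) \<in> verts B}. g t r)
      \<le> real Csp * (\<Sum>(t, r)\<in>(X \<times> Z) \<inter> verts B. g t r)"
    if g: "\<And>t s. 0 \<le> g t s" for g :: "'c \<Rightarrow> 'c \<Rightarrow> real"
  proof -
    let ?P = "{(t, s, r) \<in> P. (t, r) \<in> verts B}"
    have "card {v \<in> ?P. (fst v, snd (snd v)) = q} \<le> Csp" if "q \<in> (X \<times> Z) \<inter> verts B" for q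
    proof -
      have "card {v \<in> ?P. (fst v, snd (snd v)) = q} \<le> card {s \<in> verts T. (fst q, s) \<in> verts B}"
        using P Y finite_verts
        by (intro card_inj_on_le[of "\<lambda>v. fst (snd v)"]) (auto simp: inj_on_def)
      then show ?thesis
        using sparse_row[of "fst q"] that X by auto
    qed
    then have "(\<Sum>v\<in>?P. (\<lambda>(t, s). g t s) (fst v, snd (snd v)))
        \<le> real Csp * (\<Sum>q\<in>(X \<times> Z) \<inter> verts B. (\<lambda>(t, s). g t s) q)"
      using P g finite_verts fin
      by (intro sum_fibre_bound) (auto intro: finite_subset[OF _ fin])
    then show ?thesis
      by (simp add: case_prod_beta)
  qed
  have "(\<Sum>(t, s, r)\<in>P. csize t) \<le> real Csp * (real Csp * weight X)"
    using ts[of "\<lambda>t s. csize t"] layer_card_bound(1)[OF X Y subset_refl]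
    by (meson order_trans mult_left_mono of_nat_0_le_iff)
  moreover have "(\<Sum>(t, s, r)\<in>P. csize r) \<le> real Csp * (real Csp * weight Z)"
    using sr[of "\<lambda>s r. csize r"] layer_card_bound(2)[OF Y Z subset_refl]
    by (meson order_trans mult_left_mono of_nat_0_le_iff)
  ultimately show sizes:
    "(\<Sum>(t, s, r)\<in>P. csize t + csize r) \<le> (real Csp)\<^sup>2 * (weight X + weight Z)"
    by (simp add: case_prod_beta sum.distrib power2_eq_square algebra_simps)
  have "(\<Sum>(t, s, r)\<in>P. F t s) \<le> real Csp * (real Csp * real (Suc n) * (weight X + weight Y))"
    using ts[of F] layer_weight_bound[OF X Y n(1) subset_refl] subtree_weight_nonneg
    by (meson order_trans mult_left_mono of_nat_0_le_iff)
  then show "(\<Sum>(t, s, r)\<in>P. F t s) \<le> (real Csp)\<^sup>2 * real (Suc n) * (weight X + weight Y)"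
    by (simp add: power2_eq_square mult.assoc)
  have "(\<Sum>(t, s, r)\<in>P. F s r) \<le> real Csp * (real Csp * real (Suc n) * (weight Y + weight Z))"
    using sr[of F] layer_weight_bound[OF Y Z n(2) subset_refl] subtree_weight_nonneg
    by (meson order_trans mult_left_mono of_nat_0_le_iff)
  then show "(\<Sum>(t, s, r)\<in>P. F s r) \<le> (real Csp)\<^sup>2 * real (Suc n) * (weight Y + weight Z)"
    by (simp add: power2_eq_square mult.assoc)
  define G where "G t r = F t r - (csize t + csize r)" for t r
  have G_outside: "G t r = 0" if "(t, r) \<notin> verts B" for t r
    using that subtree_weight_outer by (simp add: G_def)
  have "0 \<le> G t r" for t r
    using size_le_subtree_weight by (simp add: G_def)
  note G_tr = tr[OF this]
  have "(\<Sum>(t, s, r)\<in>P. G t r) = (\<Sum>(t, s, r)\<in>{(t, s, r) \<in> P. (t, r) \<in> verts B}. G t r)"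
    using fin G_outside by (intro sum.mono_neutral_right) auto
  also have "\<dots> \<le> real Csp * (real Csp * real n * (weight X + weight Z))"
    using G_tr layer_proper_weight_bound[OF X Z n(1) subset_refl] unfolding G_def
    by (rule order_trans[OF _ mult_left_mono]) simp
  finally have proper:
    "(\<Sum>(t, s, r)\<in>P. G t r) \<le> (real Csp)\<^sup>2 * real n * (weight X + weight Z)"
    by (simp add: power2_eq_square mult.assoc)
  \<comment> \<open>The sizes account for one layer and \<open>G\<close> for \<open>n\<close>,
    together \<open>Suc n\<close>.\<close>
  have "(\<Sum>(t, s, r)\<in>P. F t r) = (\<Sum>(t, s, r)\<in>P. csize t + csize r) + (\<Sum>(t, s, r)\<in>P. G t r)"
    by (simp add: G_def sum.distrib[symmetric] case_prod_beta)
  then show "(\<Sum>(t, s, r)\<in>P. F t r) \<le> (real Csp)\<^sup>2 * real (Suc n) * (weight X + weight Z)"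
    using sizes proper by (simp add: algebra_simps)
qed

end


section \<open>Operation counts of layers\<close>

locale hmatrix_product = sparse_block_tree I T lab B Csp
  for I :: "'i set" and T :: "'c rtree" and lab :: "'c \<Rightarrow> 'i set"
    and B :: "('c \<times> 'c) rtree" and Csp :: nat +
  fixes Lp Lm :: "('c \<times> 'c) set" and k khat :: nat and Cad Cmg Cup :: real
  assumes leaves_B: "Lp \<union> Lm = leaves B" and disjoint_leaves: "Lp \<inter> Lm = {}"
    and local_rank_le: "\<And>t s. (t, s) \<in> leaves B \<Longrightarrow> local_rank lab Lp k t s \<le> khat"
    and k_le: "k \<le> khat"
    and Cmg_nonneg: "0 \<le> Cmg"
    and Cup: "Cad \<le> Cup" "1 \<le> Cup"
begin

abbreviation ev :: "'c \<Rightarrow> 'c \<Rightarrow> nat \<Rightarrow> real" where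
  "ev \<equiv> W_ev T lab Lp Lm k"

abbreviation up :: "'c \<Rightarrow> 'c \<Rightarrow> nat \<Rightarrow> real" where
  "up \<equiv> W_up T lab B Lm k Cad"

abbreviation mm :: "'c \<Rightarrow> 'c \<Rightarrow> 'c \<Rightarrow> real" where
  "mm \<equiv> W_mm T lab B Lp Lm k Cad Cmg"

section \<open>Costs of evaluation and update on a block subtree\<close>

lemma inadmissible_min_le:
  assumes "(t, s) \<in> Lm"
  shows "min (csize t) (csize s) \<le> real khat"
proof -
  have "(t, s) \<notin> Lp" "(t, s) \<in> leaves B"
    using assms leaves_B disjoint_leaves by auto
  then show ?thesis
    using local_rank_le[of t s] by (simp add: local_rank_def min_def split: if_splits)
qed

text \<open>The smaller size is the local rank of the leaf, hence at most \<open>khat\<close>; the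
  larger one remains as the linear factor.\<close>

lemma inadmissible_product_le:
  assumes "(t, s) \<in> Lm"
  shows "csize t * csize s \<le> real khat * max (csize t) (csize s)"
proof -
  have "csize t * csize s = min (csize t) (csize s) * max (csize t) (csize s)"
    by (simp add: min_def max_def)
  also have "\<dots> \<le> real khat * max (csize t) (csize s)"
    using inadmissible_min_le[OF assms] by (intro mult_right_mono) auto
  finally show ?thesis .
qed

lemma ev_leaf_le:
  assumes "(t, s) \<in> leaves B"
  shows "ev t s l \<le> 2 * real l * real khat * (csize t + csize s)"
proof (cases "(t, s) \<in> Lp")
  case True
  have "2 * real l * real k * (csize t + csize s) \<le> 2 * real l * real khat * (csize t + csize s)"
    using k_le by (intro mult_right_mono mult_left_mono) auto
  then show ?thesis
    using True by (simp add: W_ev.simps[of T lab Lp Lm k t s l])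
next
  case False
  then have Lm: "(t, s) \<in> Lm"
    using assms leaves_B by auto
  define c where "c = min (card (lab t)) (card (lab s))"
  have c: "real c = min (csize t) (csize s)"
    by (simp add: c_def)
  \<comment> \<open>A natural number is at most its square. With \<open>c \<le> khat\<close> this
    absorbs the additive minimum in the dense evaluation cost into a multiple of
    \<open>khat\<close>.\<close>
  have "real c \<le> real c * real c"
    using mult_le_mono2[of 1 c c] by (cases "c = 0") (auto simp flip: of_nat_mult)
  also have "\<dots> \<le> real khat * real c"
    using inadmissible_min_le[OF Lm] c by (intro mult_right_mono) auto
  finally have "min (csize t) (csize s) \<le> real khat * min (csize t) (csize s)"
    by (simp only: c)
  moreover have "0 \<le> real khat * min (csize t) (csize s)"
    by simp
  moreover have "min (csize t) (csize s) + max (csize t) (csize s) = csize t + csize s"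
    by (simp add: min_def max_def)
  then have "real khat * min (csize t) (csize s) + real khat * max (csize t) (csize s)
      = real khat * (csize t + csize s)"
    by (metis distrib_left)
  ultimately have "2 * csize t * csize s + min (csize t) (csize s)
      \<le> 2 * real khat * (csize t + csize s)"
    using inadmissible_product_le[OF Lm] by linarith
  from mult_left_mono[OF this, of "real l"] show ?thesis
    using False Lm by (simp add: W_ev.simps[of T lab Lp Lm k t s l] mult_ac)
qed

lemma ev_le:
  assumes "t \<in> verts T" "(t, s) \<in> verts B"
  shows "ev t s l \<le> 2 * real l * real khat * F t s"
  using assms
proof (induction t arbitrary: s rule: cluster_induct)
  case (cluster t)
  show ?case
  proof (cases "(t, s) \<in> leaves B")
    case True
    then show ?thesis
      using ev_leaf_le[of t s l] subtree_weight_outer[of t s] by simp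
  next
    case False
    then have inner: "(t, s) \<in> verts B - leaves B"
      using cluster.prems by simp
    have "ev t s l = (\<Sum>(t', s')\<in>sons T t \<times> sons T s. ev t' s' l)"
      using False leaves_B trees cluster.hyps by (intro W_ev_rec) auto
    also have "\<dots> \<le> (\<Sum>(t', s')\<in>sons T t \<times> sons T s. 2 * real l * real khat * F t' s')"
      using cluster.IH sons_block[OF inner] by (intro sum_mono) auto
    also have "\<dots> = 2 * real l * real khat * (\<Sum>(t', s')\<in>sons T t \<times> sons T s. F t' s')"
      by (simp add: sum_distrib_left case_prod_beta)
    also have "\<dots> \<le> 2 * real l * real khat * F t s"
      unfolding subtree_weight_inner[OF inner] by (intro mult_left_mono) auto
    finally show ?thesis .
  qed
qed

text \<open>The 4 comes from \<open>(k + l)\<^sup>2 \<le> (2 * khat)\<^sup>2\<close> in the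
  truncated addition, which also covers pairs outside \<open>B\<close>; a dense leaf needs only
  2.\<close>

lemma up_outer_le:
  assumes "(t, s) \<notin> verts B - leaves B" "l \<le> khat"
  shows "up t s l \<le> 4 * Cup * (real khat)\<^sup>2 * (csize t + csize s)"
proof (cases "(t, s) \<in> Lm")
  case True
  have "csize t * csize s \<le> real khat * (csize t + csize s)"
    using inadmissible_product_le[OF True] mult_left_mono[of "max (csize t) (csize s)" "csize t + csize s" "real khat"]
    by simp
  then have "real l * (csize t * csize s) \<le> real khat * (real khat * (csize t + csize s))"
    using assms(2) by - (rule mult_mono, auto)
  then have "real l * (csize t * csize s) \<le> (real khat)\<^sup>2 * (csize t + csize s)"
    by (simp only: power2_eq_square mult.assoc)
  moreover have "1 * ((real khat)\<^sup>2 * (csize t + csize s)) \<le> Cup * ((real khat)\<^sup>2 * (csize t + csize s))"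
    using Cup by (intro mult_right_mono) auto
  moreover have "0 \<le> (real khat)\<^sup>2 * (csize t + csize s)"
    by simp
  ultimately have "2 * (real l * (csize t * csize s)) \<le> 4 * (Cup * ((real khat)\<^sup>2 * (csize t + csize s)))"
    by linarith
  then show ?thesis
    using True assms(1) by (auto simp: W_up.simps[of T lab B Lm k Cad t s l] mult.assoc)
next
  case False
  have "Cad * (real k + real l)\<^sup>2 \<le> Cup * (2 * real khat)\<^sup>2"
    using Cup k_le assms(2) by (intro mult_mono power_mono) auto
  then have "Cad * (real k + real l)\<^sup>2 * (csize t + csize s)
      \<le> Cup * (2 * real khat)\<^sup>2 * (csize t + csize s)"
    by (intro mult_right_mono) auto
  then show ?thesis
    using False assms(1)
    by (auto simp: W_up.simps[of T lab B Lm k Cad t s l] power_mult_distrib mult_ac)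
qed

text \<open>The pair is not assumed to be a block: updates go to the outer pair
  \<open>(t, r)\<close> of a product triple, which may lie outside \<open>B\<close>, and
  \<open>F\<close> treats it as a leaf then.\<close>

lemma up_le:
  assumes "t \<in> verts T" "l \<le> khat"
  shows "up t s l \<le> 4 * Cup * (real khat)\<^sup>2 * F t s"
  using assms
proof (induction t arbitrary: s rule: cluster_induct)
  case (cluster t)
  show ?case
  proof (cases "(t, s) \<in> verts B - leaves B")
    case False
    then show ?thesis
      using up_outer_le[of t s l] subtree_weight_outer[of t s] cluster.prems by simp
  next
    case True
    have "up t s l = (\<Sum>(t', s')\<in>sons T t \<times> sons T s. up t' s' l)"
      using True trees cluster.hyps by (intro W_up_rec)
    also have "\<dots> \<le> (\<Sum>(t', s')\<in>sons T t \<times> sons T s. 4 * Cup * (real khat)\<^sup>2 * F t' s')"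
      using cluster.IH cluster.prems by (intro sum_mono) auto
    also have "\<dots> = 4 * Cup * (real khat)\<^sup>2 * (\<Sum>(t', s')\<in>sons T t \<times> sons T s. F t' s')"
      by (simp add: sum_distrib_left case_prod_beta)
    also have "\<dots> \<le> 4 * Cup * (real khat)\<^sup>2 * F t s"
      unfolding subtree_weight_inner[OF True] using Cup by (intro mult_left_mono) auto
    finally show ?thesis .
  qed
qed

lemma ev_rank_le:
  assumes "(t, s) \<in> verts B" "l \<le> khat"
  shows "ev t s l \<le> 2 * (real khat)\<^sup>2 * F t s"
proof -
  have "ev t s l \<le> 2 * real l * real khat * F t s"
    using assms block_clusters by (intro ev_le) auto
  also have "\<dots> \<le> 2 * real khat * real khat * F t s"
    using assms subtree_weight_nonneg by (intro mult_right_mono mult_left_mono) auto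
  finally show ?thesis
    by (simp add: power2_eq_square mult.assoc)
qed

section \<open>Cost of a single triple of the product tree\<close>

lemma mm_left_leaf_le:
  assumes "(t, s) \<in> leaves B" "(s, r) \<in> verts B"
  shows "mm t s r \<le> 2 * (real khat)\<^sup>2 * F s r + 4 * Cup * (real khat)\<^sup>2 * F t r"
proof -
  have "t \<in> verts T"
    using assms block_clusters[of t s] by (simp add: leaves_def)
  then show ?thesis
    using assms local_rank_le[OF assms(1)] ev_rank_le[OF assms(2)] up_le[of t]
    by (simp add: W_mm.simps[of T lab B Lp Lm k Cad Cmg t s r] add_mono)
qed

lemma mm_right_leaf_le:
  assumes "(t, s) \<in> verts B - leaves B" "(s, r) \<in> leaves B"
  shows "mm t s r \<le> 2 * (real khat)\<^sup>2 * F t s + 4 * Cup * (real khat)\<^sup>2 * F t r"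
proof -
  have "t \<in> verts T"
    using assms block_clusters[of t s] by simp
  then show ?thesis
    using assms local_rank_le[OF assms(2)] ev_rank_le[of t s] up_le[of t]
    by (simp add: W_mm.simps[of T lab B Lp Lm k Cad Cmg t s r] add_mono)
qed

lemma mm_inner_le:
  assumes "(t, s) \<in> verts B - leaves B" "(s, r) \<in> verts B - leaves B"
  shows "mm t s r \<le> Cmg * (real khat)\<^sup>2 * (csize t + csize r)
    + (\<Sum>(t', s', r')\<in>sons T t \<times> sons T s \<times> sons T r. mm t' s' r')"
proof -
  have "mm t s r = Cmg * (real k)\<^sup>2 * (csize t + csize r)
    + (\<Sum>(t', s', r')\<in>sons T t \<times> sons T s \<times> sons T r. mm t' s' r')"
    using assms trees block_clusters[of t s] by (intro W_mm_rec) auto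
  moreover have "Cmg * (real k)\<^sup>2 * (csize t + csize r) \<le> Cmg * (real khat)\<^sup>2 * (csize t + csize r)"
    using Cmg_nonneg k_le by (intro mult_right_mono mult_left_mono power_mono) auto
  ultimately show ?thesis
    by linarith
qed

section \<open>Summation over the layers of the product tree\<close>

definition layer_bound :: "nat \<Rightarrow> real \<Rightarrow> real \<Rightarrow> real \<Rightarrow> real" where
  "layer_bound n x y z = (real Csp)\<^sup>2 * (real khat)\<^sup>2 *
     (real n * (real n + 1) / 2 * (2 * (x + y) + 2 * (y + z) + 4 * Cup * (x + z))
      + real n * (Cmg * (x + z)))"

lemma layer_bound_mono:
  assumes "x \<le> x'" "y \<le> y'" "z \<le> z'"
  shows "layer_bound n x y z \<le> layer_bound n x' y' z'"
  unfolding layer_bound_def using assms Cup Cmg_nonneg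
  by (intro mult_left_mono add_mono) auto

text \<open>With \<open>j\<close> layers left, the current layer pays the leaf costs
  \<open>j\<close> times and the merging cost once. Summing \<open>j\<close> from 1 to
  \<open>n\<close> gives the triangular number in \<open>layer_bound\<close>.\<close>

lemma layer_bound_Suc:
  "layer_bound (Suc n) x y z = (real Csp)\<^sup>2 * (real khat)\<^sup>2 *
     (real (Suc n) * (2 * (x + y) + 2 * (y + z) + 4 * Cup * (x + z)) + Cmg * (x + z))
     + layer_bound n x y z"
  by (simp add: layer_bound_def field_simps)

text \<open>The current layer is paid by \<open>triple_layer_bounds\<close>; the sons of its triples
  lie in the next one, whose weights are no larger. Only \<open>X\<close> and \<open>Y\<close> have
  to run out, since each subtree weight involved has its first cluster in one of them.\<close>

lemma mm_layer_le:
  assumes "X \<subseteq> verts T" "Y \<subseteq> verts T" "Z \<subseteq> verts T"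
    and "P \<subseteq> {(t, s, r). t \<in> X \<and> s \<in> Y \<and> r \<in> Z \<and> (t, s) \<in> verts B \<and> (s, r) \<in> verts B}"
    and "(edges T ^^ n) `` X = {}" "(edges T ^^ n) `` Y = {}"
  shows "(\<Sum>(t, s, r)\<in>P. mm t s r) \<le> layer_bound n (weight X) (weight Y) (weight Z)"
  using assms
proof (induction n arbitrary: X Y Z P)
  case 0
  then have "P = {}"
    by auto
  then show ?case
    by (simp add: layer_bound_def)
next
  case (Suc n)
  note P = Suc.prems(4)
  let ?q = "(real khat)\<^sup>2"
  \<comment> \<open>\<open>g\<close> adds the costs of both kinds of leaf and of merging, so leaf
    and inner triples need not be separated in the sum.\<close>
  define g where "g = (\<lambda>(t, s, r). 2 * ?q * F t s + 2 * ?q * F s r + 4 * Cup * ?q * F t r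
    + Cmg * ?q * (csize t + csize r))"
  define P' where "P' = (\<Union>v\<in>P. product_sons T B v)"
  have mem: "t \<in> X" "s \<in> Y" "r \<in> Z" "t \<in> verts T" "s \<in> verts T" "r \<in> verts T"
    "(t, s) \<in> verts B" "(s, r) \<in> verts B"
    if "(t, s, r) \<in> P" for t s r
    using that P Suc.prems(1-3) by auto
  have fin: "finite P"
    using mem finite_verts by (intro finite_subset[of P "verts T \<times> verts T \<times> verts T"]) auto
  have "(\<Sum>v\<in>P. (\<lambda>(t, s, r). mm t s r) v)
      \<le> (\<Sum>v\<in>P. g v) + (\<Sum>v\<in>P'. (\<lambda>(t, s, r). mm t s r) v)"
    unfolding P'_def
  proof (rule sum_sons_bound[OF fin])
    fix v assume v: "v \<in> P"
    obtain t s r where [simp]: "v = (t, s, r)"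
      by (cases v)
    note m = mem[OF v[simplified]]
    show "finite (product_sons T B v)"
      using m finite_sons by (auto simp: product_sons_def)
    have nonneg: "0 \<le> ?q * F t s" "0 \<le> ?q * F s r" "0 \<le> Cup * ?q * F t r"
      "0 \<le> Cmg * ?q * (csize t + csize r)"
      using Cup Cmg_nonneg subtree_weight_nonneg by auto
    have "mm t s r \<le> g v" if "(t, s) \<in> leaves B \<or> (s, r) \<in> leaves B"
      using that mm_left_leaf_le[of t s r] mm_right_leaf_le[of t s r] m nonneg
      unfolding g_def by (cases "(t, s) \<in> leaves B") (auto simp: mult.assoc)
    moreover have "mm t s r \<le> g v + (\<Sum>(t, s, r)\<in>product_sons T B v. mm t s r)"
      if "(t, s) \<notin> leaves B" "(s, r) \<notin> leaves B"
      using that mm_inner_le[of t s r] m nonneg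
      by (auto simp: g_def product_sons_def mult.assoc)
    ultimately show "(\<lambda>(t, s, r). mm t s r) v
        \<le> g v + (\<Sum>w\<in>product_sons T B v. (\<lambda>(t, s, r). mm t s r) w)"
      by (cases "(t, s) \<in> leaves B \<or> (s, r) \<in> leaves B") (auto simp: product_sons_def)
  next
    fix v w assume *: "v \<in> P" "w \<in> P" "v \<noteq> w"
    obtain t s r t' s' r' where vw: "v = (t, s, r)" "w = (t', s', r')"
      by (cases v, cases w)
    note m = mem(4-6)[OF *(1)[unfolded vw]] mem(4-6)[OF *(2)[unfolded vw]]
    have "t \<noteq> t' \<or> s \<noteq> s' \<or> r \<noteq> r'"
      using *(3) vw by auto
    then have "sons T t \<inter> sons T t' = {} \<or> sons T s \<inter> sons T s' = {} \<or> sons T r \<inter> sons T r' = {}"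
      using m sons_disjoint[of t t'] sons_disjoint[of s s'] sons_disjoint[of r r'] by blast
    then show "product_sons T B v \<inter> product_sons T B w = {}"
      by (auto simp: product_sons_def vw)
  qed
  moreover have "(\<Sum>v\<in>P. g v) \<le> (real Csp)\<^sup>2 * ?q * (real (Suc n) * (2 * (weight X + weight Y)
      + 2 * (weight Y + weight Z) + 4 * Cup * (weight X + weight Z)) + Cmg * (weight X + weight Z))"
  proof -
    note bounds = triple_layer_bounds[OF Suc.prems]
    have "(\<Sum>v\<in>P. g v) = 2 * ?q * (\<Sum>(t, s, r)\<in>P. F t s) + 2 * ?q * (\<Sum>(t, s, r)\<in>P. F s r)
        + 4 * Cup * ?q * (\<Sum>(t, s, r)\<in>P. F t r) + Cmg * ?q * (\<Sum>(t, s, r)\<in>P. csize t + csize r)"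
      by (simp add: g_def case_prod_beta sum.distrib sum_distrib_left distrib_left)
    also have "\<dots> \<le> 2 * ?q * ((real Csp)\<^sup>2 * real (Suc n) * (weight X + weight Y))
        + 2 * ?q * ((real Csp)\<^sup>2 * real (Suc n) * (weight Y + weight Z))
        + 4 * Cup * ?q * ((real Csp)\<^sup>2 * real (Suc n) * (weight X + weight Z))
        + Cmg * ?q * ((real Csp)\<^sup>2 * (weight X + weight Z))"
      using Cup Cmg_nonneg bounds by (intro add_mono mult_left_mono) auto
    also have "\<dots> = (real Csp)\<^sup>2 * ?q * (real (Suc n) * (2 * (weight X + weight Y)
      + 2 * (weight Y + weight Z) + 4 * Cup * (weight X + weight Z)) + Cmg * (weight X + weight Z))"
      by (simp add: algebra_simps)
    finally show ?thesis .
  qed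
  moreover have "(\<Sum>v\<in>P'. (\<lambda>(t, s, r). mm t s r) v)
      \<le> layer_bound n (weight (edges T `` X)) (weight (edges T `` Y)) (weight (edges T `` Z))"
  proof (rule Suc.IH)
    have "product_sons T B (t, s, r) \<subseteq> {(t, s, r). t \<in> edges T `` X \<and> s \<in> edges T `` Y
        \<and> r \<in> edges T `` Z \<and> (t, s) \<in> verts B \<and> (s, r) \<in> verts B}" if "(t, s, r) \<in> P" for t s r
      using mem[OF that] sons_block[of t s] sons_block[of s r]
      by (auto simp: product_sons_def edges_def)
    then show "P' \<subseteq> {(t, s, r). t \<in> edges T `` X \<and> s \<in> edges T `` Y
        \<and> r \<in> edges T `` Z \<and> (t, s) \<in> verts B \<and> (s, r) \<in> verts B}"
      unfolding P'_def by (intro UN_least) (simp only: split_paired_all)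
    show "edges T `` X \<subseteq> verts T" "edges T `` Y \<subseteq> verts T" "edges T `` Z \<subseteq> verts T"
      by (rule edges_Image_verts, fact)+
    show "(edges T ^^ n) `` edges T `` X = {}" "(edges T ^^ n) `` edges T `` Y = {}"
      using Suc.prems(5,6) unfolding relpow_Image_Suc .
  qed
  moreover have "\<dots> \<le> layer_bound n (weight X) (weight Y) (weight Z)"
    using Suc.prems(1-3) by (intro layer_bound_mono weight_edges_le)
  ultimately show ?case
    unfolding layer_bound_Suc by (simp add: case_prod_beta)
qed

section \<open>The three kinds of starting triples\<close>

lemma mm_inner_triple_le:
  assumes ts: "(t, s) \<in> verts B - leaves B" and sr: "(s, r) \<in> verts B - leaves B"
    and depth: "(edges T ^^ Suc p) `` {t} = {}" "(edges T ^^ Suc p) `` {s} = {}"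
    and "Csp \<ge> 1"
  shows "mm t s r \<le> (4 + 2 * Cup + Cmg) * (real Csp)\<^sup>2 * (real p + 1)\<^sup>2 * (real khat)\<^sup>2
    * (csize t + csize s + csize r)"
proof -
  let ?q = "(real Csp)\<^sup>2 * (real khat)\<^sup>2" and ?N = "csize t + csize s + csize r"
  have v: "t \<in> verts T" "s \<in> verts T" "r \<in> verts T"
    using ts sr block_clusters by auto
  \<comment> \<open>The starting triple pays only for merging. Its sons head at most
    \<open>p\<close> layers, so the leaf costs get the factor \<open>p * (p + 1) / 2\<close> and not
    \<open>(p + 1) * (p + 2) / 2\<close>.\<close>
  have "(\<Sum>(t', s', r')\<in>sons T t \<times> sons T s \<times> sons T r. mm t' s' r')
      \<le> layer_bound p (weight (sons T t)) (weight (sons T s)) (weight (sons T r))"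
  proof (rule mm_layer_le)
    have "edges T `` {t} = sons T t" "edges T `` {s} = sons T s"
      using v by (auto simp: edges_def)
    then show "(edges T ^^ p) `` sons T t = {}" "(edges T ^^ p) `` sons T s = {}"
      using depth unfolding relpow_Image_Suc by simp_all
  qed (use v sons_verts sons_block[OF ts] sons_block[OF sr] in auto)
  also have "\<dots> \<le> layer_bound p (csize t) (csize s) (csize r)"
    using v by (intro layer_bound_mono weight_sons_le)
  finally have sons: "(\<Sum>(t', s', r')\<in>sons T t \<times> sons T s \<times> sons T r. mm t' s' r') \<le> \<dots>" .
  have q: "(real khat)\<^sup>2 \<le> ?q"
    using \<open>Csp \<ge> 1\<close> mult_right_mono[of 1 "(real Csp)\<^sup>2" "(real khat)\<^sup>2"] by simp
  have "mm t s r \<le> (real khat)\<^sup>2 * (Cmg * (csize t + csize r)) + layer_bound p (csize t) (csize s) (csize r)"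
    using mm_inner_le[OF ts sr] sons by (simp add: mult_ac)
  also have "\<dots> \<le> ?q * (Cmg * (csize t + csize r)) + layer_bound p (csize t) (csize s) (csize r)"
    using q Cmg_nonneg by (intro add_right_mono mult_right_mono) auto
  also have "\<dots> = ?q * (real p * (real p + 1) / 2 * (2 * (csize t + csize s) + 2 * (csize s + csize r)
      + 4 * Cup * (csize t + csize r)) + (real p + 1) * (Cmg * (csize t + csize r)))"
    by (simp add: layer_bound_def algebra_simps)
  \<comment> \<open>\<open>8 + 4 * Cup\<close> is twice the \<open>4 + 2 * Cup\<close> of the claim,
    matching the division by 2. The evaluation terms alone would need 4 in place of 8.\<close>
  also have "\<dots> \<le> ?q * ((real p + 1)\<^sup>2 / 2 * ((8 + 4 * Cup) * ?N) + (real p + 1)\<^sup>2 * (Cmg * ?N))"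
  proof -
    have "real p * (real p + 1) \<le> (real p + 1)\<^sup>2" "real p + 1 \<le> (real p + 1)\<^sup>2"
      by (auto simp: power2_eq_square algebra_simps)
    moreover have "Cup * (csize t + csize r) \<le> Cup * ?N" "Cmg * (csize t + csize r) \<le> Cmg * ?N"
      using Cup Cmg_nonneg by (auto intro: mult_left_mono)
    moreover from this(1) have "2 * (csize t + csize s) + 2 * (csize s + csize r)
        + 4 * Cup * (csize t + csize r) \<le> (8 + 4 * Cup) * ?N"
      by (simp add: algebra_simps)
    ultimately show ?thesis
      using Cup Cmg_nonneg by (intro mult_left_mono add_mono mult_mono divide_right_mono) auto
  qed
  also have "\<dots> = (4 + 2 * Cup + Cmg) * (real Csp)\<^sup>2 * (real p + 1)\<^sup>2 * (real khat)\<^sup>2 * ?N"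
    by (simp add: field_simps)
  finally show ?thesis .
qed

text \<open>A product leaf costs \<open>2 + 4 * Cup\<close> per cluster index with a single factor \<open>Csp * (p + 1)\<close>, so
  the second factor \<open>Csp * (p + 1) \<ge> 2\<close> turns \<open>4 * Cup\<close> into \<open>2 * Cup\<close>.\<close>

lemma mm_leaf_triple_le:
  assumes ts: "(t, s) \<in> verts B" and sr: "(s, r) \<in> verts B"
    and leaf: "(t, s) \<in> leaves B \<or> (s, r) \<in> leaves B"
    and depth: "(edges T ^^ Suc p) `` {t} = {}" "(edges T ^^ Suc p) `` {s} = {}"
    and two: "2 \<le> Csp * (p + 1)"
  shows "mm t s r \<le> (4 + 2 * Cup + Cmg) * (real Csp)\<^sup>2 * (real p + 1)\<^sup>2 * (real khat)\<^sup>2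
    * (csize t + csize s + csize r)"
proof -
  let ?d = "real Csp * (real p + 1)" and ?q = "(real khat)\<^sup>2" and ?N = "csize t + csize s + csize r"
  have v: "t \<in> verts T" "s \<in> verts T" "r \<in> verts T"
    using ts sr block_clusters by auto
  have d: "2 \<le> ?d"
    using two by (metis of_nat_1 of_nat_add of_nat_le_iff of_nat_mult of_nat_numeral)
  \<comment> \<open>The layer bound for two singleton layers and a single block.\<close>
  have block: "F x y \<le> ?d * (csize x + csize y)"
    if "(x, y) \<in> verts B" "(edges T ^^ Suc p) `` {x} = {}" for x y
    using layer_weight_bound[of "{x}" "{y}" "Suc p" "{(x, y)}"] that block_clusters[OF that(1)]
    by (simp add: mult.assoc add.commute del: relpow.simps)
  have F_ev: "F t s \<le> ?d * ?N" "F s r \<le> ?d * ?N"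
    using block[OF ts depth(1)] block[OF sr depth(2)] d
      mult_left_mono[of "csize t + csize s" ?N ?d] mult_left_mono[of "csize s + csize r" ?N ?d]
    by linarith+
  have F_up: "F t r \<le> ?d * ?N"
  proof (cases "(t, r) \<in> verts B")
    case True
    then show ?thesis
      using block[OF True depth(1)] d mult_left_mono[of "csize t + csize r" ?N ?d] by linarith
  next
    case False
    then have "F t r \<le> 1 * ?N"
      using subtree_weight_outer[of t r] by simp
    also have "\<dots> \<le> ?d * ?N"
      using d by (intro mult_right_mono) auto
    finally show ?thesis .
  qed
  have "mm t s r \<le> 2 * ?q * (?d * ?N) + 4 * Cup * ?q * (?d * ?N)"
  proof -
    have "2 * ?q * F t s \<le> 2 * ?q * (?d * ?N)" "2 * ?q * F s r \<le> 2 * ?q * (?d * ?N)"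
      "4 * Cup * ?q * F t r \<le> 4 * Cup * ?q * (?d * ?N)"
      using F_ev F_up Cup by (auto intro!: mult_left_mono simp del: mult_le_cancel_left_pos)
    then show ?thesis
      using leaf mm_left_leaf_le[of t s r] mm_right_leaf_le[of t s r] ts sr
      by (cases "(t, s) \<in> leaves B") auto
  qed
  also have "\<dots> = (1 + 2 * Cup) * (2 * ?d) * (?q * ?N)"
    by (simp add: algebra_simps)
  also have "\<dots> \<le> (4 + 2 * Cup + Cmg) * (?d * ?d) * (?q * ?N)"
    using d Cup Cmg_nonneg by (intro mult_right_mono mult_mono) auto
  finally show ?thesis
    by (simp add: power2_eq_square mult_ac)
qed

text \<open>Meant for \<open>Csp * (p + 1) = 1\<close>, where no second factor halves
  \<open>4 * Cup\<close>. The sizes add up to \<open>3 * csize t\<close>, so an admissible block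
  requires \<open>4 + 8 * Cad \<le> 3 * (4 + 2 * Cup + Cmg)\<close>. As
  \<open>Cad \<le> Cup\<close>, this follows from \<open>2 * Cad \<le> 8 + 3 * Cmg\<close>, and for
  \<open>Cad = Cup\<close> it is equivalent to it.\<close>

lemma mm_single_block_le:
  assumes leaf: "(t, t) \<in> leaves B"
    and Cad: "(t, t) \<in> Lp \<Longrightarrow> 2 * Cad \<le> 8 + 3 * Cmg"
  shows "mm t t t \<le> (4 + 2 * Cup + Cmg) * (real khat)\<^sup>2 * (csize t + csize t + csize t)"
proof (cases "(t, t) \<in> Lp")
  case True
  then have "(t, t) \<notin> Lm"
    using disjoint_leaves by auto
  then have "mm t t t = (4 + 8 * Cad) * ((real k)\<^sup>2 * csize t)"
    using leaf True
    by (simp add: W_mm.simps[of T lab B Lp Lm k Cad Cmg t t t] W_ev.simps[of T lab Lp Lm k t t]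
        W_up.simps[of T lab B Lm k Cad t t] local_rank_def power2_eq_square algebra_simps)
  also have "\<dots> \<le> (3 * (4 + 2 * Cup + Cmg)) * ((real khat)\<^sup>2 * csize t)"
    using Cad[OF True] Cup Cmg_nonneg k_le by (intro mult_mono power_mono) auto
  finally show ?thesis
    by (simp add: algebra_simps)
next
  case False
  then have Lm: "(t, t) \<in> Lm"
    using leaf leaves_B by auto
  have rank: "local_rank lab Lp k t t = card (lab t)"
    using False by (simp add: local_rank_def)
  have khat: "csize t \<le> real khat"
    using local_rank_le[OF leaf] rank by simp
  \<comment> \<open>Again a natural number against its square: the quadratic term of the dense cost
    becomes cubic, for a total constant of 5.\<close>
  have "csize t \<le> csize t * csize t"
    by (cases "card (lab t)") auto
  then have "csize t * csize t \<le> csize t * csize t * csize t"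
    using mult_left_mono[of "csize t" "csize t * csize t" "csize t"] by (simp add: mult.assoc)
  moreover have "mm t t t = 4 * (csize t * csize t * csize t) + csize t * csize t"
    using leaf False Lm rank
    by (simp add: W_mm.simps[of T lab B Lp Lm k Cad Cmg t t t] W_ev.simps[of T lab Lp Lm k t t]
        W_up.simps[of T lab B Lm k Cad t t] algebra_simps)
  ultimately have "mm t t t \<le> 5 * ((csize t)\<^sup>2 * csize t)"
    by (simp add: power2_eq_square)
  also have "\<dots> \<le> (3 * (4 + 2 * Cup + Cmg)) * ((real khat)\<^sup>2 * csize t)"
    using khat Cup Cmg_nonneg by (intro mult_mono power_mono) auto
  finally show ?thesis
    by (simp add: algebra_simps)
qed

end


text \<open>Two hypotheses go beyond the English statement. \<open>no_admissible\<close> secures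
  \<open>k \<le> khat\<close> when \<open>khat\<close> is formed from block sizes alone.
  \<open>single_admissible_block\<close> concerns a matrix consisting of one admissible block, where
  \<open>Cmm\<close> is too small for large \<open>Cad\<close> if \<open>I\<close> is
  nonempty.\<close>

theorem theorem9:
  fixes I :: "'i set" and T :: "'c rtree" and lab :: "'c \<Rightarrow> 'i set"
    and B :: "('c \<times> 'c) rtree" and Lp Lm :: "('c \<times> 'c) set"
    and m p Csp k khat :: nat and Cad Cmg Cup Cmm :: real
  assumes "finite I"
    and "is_cluster_tree I T lab"
    and "is_block_tree T B"
    and "Lp \<union> Lm = leaves B" and "Lp \<inter> Lm = {}"
    and inadmissible: "\<And>t s. (t, s) \<in> Lm \<Longrightarrow> t \<in> leaves T \<or> s \<in> leaves T"
    and "m \<ge> 1" and leaf_size: "\<And>t. t \<in> leaves T \<Longrightarrow> card (lab t) \<le> m"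
    and depth: "\<And>t. t \<in> verts T \<Longrightarrow> level T t \<le> p"
    and "Csp \<ge> 1"
    and sparse_row: "\<And>t. t \<in> verts T \<Longrightarrow> card {s \<in> verts T. (t, s) \<in> verts B} \<le> Csp"
    and sparse_col: "\<And>s. s \<in> verts T \<Longrightarrow> card {t \<in> verts T. (t, s) \<in> verts B} \<le> Csp"
    and "k \<ge> 1"
    and "Cmg \<ge> 0"
    and khat: "khat = max_local_rank lab B Lp k"
    and no_admissible: "Lp = {} \<Longrightarrow> k \<le> khat"
    and single_admissible_block:
      "p = 0 \<Longrightarrow> Csp = 1 \<Longrightarrow> (root T, root T) \<in> Lp \<Longrightarrow> 2 * Cad \<le> 8 + 3 * Cmg"
    and Cup: "Cup = max Cad 1"
    and Cmm: "Cmm = 4 + 2 * Cup + Cmg"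
    and "(t, s, r) \<in> verts (product_tree T B)"
  shows "W_mm T lab B Lp Lm k Cad Cmg t s r
    \<le> Cmm * (real Csp)\<^sup>2 * (real p + 1)\<^sup>2 * (real khat)\<^sup>2
        * (real (card (lab t)) + real (card (lab s)) + real (card (lab r)))"
proof -
  have cluster: "rooted_tree T" and block: "rooted_tree B" "root B = (root T, root T)"
    using \<open>is_cluster_tree I T lab\<close> \<open>is_block_tree T B\<close>
    by (auto simp: is_cluster_tree_def is_block_tree_def)
  have fin: "finite {local_rank lab Lp k t s | t s. (t, s) \<in> leaves B}"
  proof -
    have "{local_rank lab Lp k t s | t s. (t, s) \<in> leaves B}
        = (\<lambda>(t, s). local_rank lab Lp k t s) ` leaves B"
      by auto
    moreover have "finite (leaves B)"
      using block by (simp add: leaves_def rooted_tree_def)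
    ultimately show ?thesis
      by simp
  qed
  have rank: "local_rank lab Lp k t s \<le> khat" if "(t, s) \<in> leaves B" for t s
    unfolding khat max_local_rank_def using that by (intro Max_ge fin) auto
  have "k \<le> khat"
  proof (cases "Lp = {}")
    case False
    then obtain t s where "(t, s) \<in> Lp"
      by auto
    then show ?thesis
      using rank[of t s] \<open>Lp \<union> Lm = leaves B\<close> by (auto simp: local_rank_def)
  qed (fact no_admissible)
  then interpret hmatrix_product I T lab B Csp Lp Lm k khat Cad Cmg Cup
    using assms rank by unfold_locales auto
  have ts: "(t, s) \<in> verts B" and sr: "(s, r) \<in> verts B"
    using product_tree_blocks[OF \<open>is_block_tree T B\<close> \<open>(t, s, r) \<in> verts (product_tree T B)\<close>]
    by auto
  have v: "t \<in> verts T" "s \<in> verts T" "r \<in> verts T"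
    using block_clusters ts sr by auto
  have path: "(edges T ^^ Suc p) `` {t} = {}" "(edges T ^^ Suc p) `` {s} = {}"
    using no_descendants_beyond_depth[OF cluster _ depth] v by blast+
  \<comment> \<open>Apart from inner triples, the question is whether a second factor
    \<open>Csp * (p + 1)\<close> of at least 2 is available.\<close>
  consider "(t, s) \<notin> leaves B" "(s, r) \<notin> leaves B"
    | "(t, s) \<in> leaves B \<or> (s, r) \<in> leaves B" "2 \<le> Csp * (p + 1)"
    | "(t, s) \<in> leaves B \<or> (s, r) \<in> leaves B" "Csp * (p + 1) = 1"
  proof -
    have "1 \<le> Csp * (p + 1)"
      using \<open>Csp \<ge> 1\<close> by simp
    then have "2 \<le> Csp * (p + 1) \<or> Csp * (p + 1) = 1"
      by linarith
    then show ?thesis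
      using that by blast
  qed
  then show ?thesis
  proof cases
    case 1
    then show ?thesis
      using mm_inner_triple_le[OF _ _ path \<open>Csp \<ge> 1\<close>] ts sr Cmm by simp
  next
    case 2
    then show ?thesis
      using mm_leaf_triple_le[OF ts sr _ path] Cmm by simp
  next
    case 3
    \<comment> \<open>Depth 0 leaves the root as the only cluster, so the triple is the root of the
      product tree.\<close>
    have "Csp = 1" "p = 0"
      using 3(2) unfolding nat_mult_eq_1_iff by auto
    then have "t = root T" "s = root T" "r = root T"
      using v depth depth_zero_root[OF cluster] by auto
    then show ?thesis
      using 3(1) mm_single_block_le[of "root T"] single_admissible_block Cmm \<open>Csp = 1\<close> \<open>p = 0\<close>
      by simp
  qed
qed

end
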